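(* Let $p$ be a positive integer and let $(G,\sigma)$ be a signed graph (with a fixed orientation $\tau$) whose underlying graph $G$ is odd-$(2p+1)$-edge-connected. Then $(G,\sigma)$ admits a modulo circular $(2+\frac{1}{p})$-flow if and only if it admits an integer-valued circular $(2+\frac{1}{p})$-flow.
   Context: Graphs may have multiple edges and loops. An edge set $F$ is an odd-$\lambda$-edge cut if $|F|=\lambda$ is odd and $G-F$ has more components than $G$; $G$ is odd-$\lambda$-edge-connected if it contains no odd-$k$-edge cut for any $k\le\lambda-2$. A signed graph $(G,\sigma)$ is a graph $G$ with a signature $\sigma\colon E(G)\to\{\pm1\}$. Each edge consists of two half-edges, each incident with exactly one end of the edge; $H(v)$ denotes the set of half-edges incident with $v$, $H(G)=\bigcup_v H(v)$, and $e_h$ is the edge containing half-edge $h$. An orientation of $(G,\sigma)$ is a map $\tau\colon H(G)\to\{\pm1\}$ with $\tau(h_1)\tau(h_2)=-\sigma(e)$ for every edge $e$ with half-edges $h_1,h_2$. For $f\colon E(G)\to\mathbb{Z}$, the boundary at $v$ is $\partial f(v)=\sum_{h\in H(v)} f(e_h)\tau(h)$. For positive integers $k,d$, an integer-valued (resp. modulo) circular $\frac{k}{d}$-flow is a map $f\colon E(G)\to\mathbb{Z}$ with $d\le |f(e)|\le k-d$ for every edge $e$ and $\partial f(v)=0$ (resp. $\partial f(v)\equiv 0\pmod k$) for every vertex $v$. Here $2+\frac1p=\frac{2p+1}{p}$, so a circular $(2+\frac1p)$-flow has $p\le|f(e)|\le p+1$ and the modulus is $2p+1$. *)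

theory Defs
  imports Main "HOL-Number_Theory.Cong"
begin

text \<open>
  Finite graphs with multiple edges and loops. The two half-edges of an edge \<open>e\<close> are the pairs
  \<open>(e, False)\<close> and \<open>(e, True)\<close>, and \<open>endpoint\<close> maps a half-edge to the vertex it is incident with.
  A loop is an edge whose two half-edges have the same endpoint; both of them count at that vertex.
\<close>

record ('v, 'e) multigraph =
  vertices :: "'v set"
  edges :: "'e set"
  endpoint :: "'e \<times> bool \<Rightarrow> 'v"

definition half_edges :: "('v, 'e) multigraph \<Rightarrow> ('e \<times> bool) set" where
  "half_edges G = edges G \<times> UNIV"

definition half_edges_at :: "('v, 'e) multigraph \<Rightarrow> 'v \<Rightarrow> ('e \<times> bool) set" where
  "half_edges_at G v = {h \<in> half_edges G. endpoint G h = v}"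

definition finite_multigraph :: "('v, 'e) multigraph \<Rightarrow> bool" where
  "finite_multigraph G \<longleftrightarrow>
     finite (vertices G) \<and> finite (edges G) \<and> (\<forall>h \<in> half_edges G. endpoint G h \<in> vertices G)"

definition adjacency :: "('v, 'e) multigraph \<Rightarrow> ('v \<times> 'v) set" where
  "adjacency G = {(endpoint G (e, b), endpoint G (e, \<not> b)) | e b. e \<in> edges G}"

definition components :: "('v, 'e) multigraph \<Rightarrow> 'v set set" where
  "components G = vertices G // {(u, v) \<in> vertices G \<times> vertices G. (u, v) \<in> (adjacency G)\<^sup>*}"

definition delete_edges :: "('v, 'e) multigraph \<Rightarrow> 'e set \<Rightarrow> ('v, 'e) multigraph" where
  "delete_edges G F = G\<lparr>edges := edges G - F\<rparr>"

definition odd_edge_cut :: "('v, 'e) multigraph \<Rightarrow> nat \<Rightarrow> 'e set \<Rightarrow> bool" where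
  "odd_edge_cut G l F \<longleftrightarrow>
     F \<subseteq> edges G \<and> card F = l \<and> odd l \<and>
     card (components (delete_edges G F)) > card (components G)"

text \<open>The bound \<open>k \<le> l - 2\<close> is written additively to avoid truncated subtraction.\<close>

definition odd_edge_connected :: "nat \<Rightarrow> ('v, 'e) multigraph \<Rightarrow> bool" where
  "odd_edge_connected l G \<longleftrightarrow> (\<forall>k. k + 2 \<le> l \<longrightarrow> \<not> (\<exists>F. odd_edge_cut G k F))"

definition signature :: "('v, 'e) multigraph \<Rightarrow> ('e \<Rightarrow> int) \<Rightarrow> bool" where
  "signature G \<sigma> \<longleftrightarrow> (\<forall>e \<in> edges G. \<sigma> e \<in> {1, -1})"

definition orientation ::
    "('v, 'e) multigraph \<Rightarrow> ('e \<Rightarrow> int) \<Rightarrow> ('e \<times> bool \<Rightarrow> int) \<Rightarrow> bool" where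
  "orientation G \<sigma> \<tau> \<longleftrightarrow>
     (\<forall>h \<in> half_edges G. \<tau> h \<in> {1, -1}) \<and>
     (\<forall>e \<in> edges G. \<tau> (e, False) * \<tau> (e, True) = - \<sigma> e)"

definition boundary ::
    "('v, 'e) multigraph \<Rightarrow> ('e \<times> bool \<Rightarrow> int) \<Rightarrow> ('e \<Rightarrow> int) \<Rightarrow> 'v \<Rightarrow> int" where
  "boundary G \<tau> f v = (\<Sum>h \<in> half_edges_at G v. f (fst h) * \<tau> h)"

text \<open>Circular \<open>k/d\<close>-flows; the rational \<open>k/d\<close> is represented by the pair \<open>k\<close>, \<open>d\<close>.\<close>

definition integer_circular_flow ::
    "('v, 'e) multigraph \<Rightarrow> ('e \<times> bool \<Rightarrow> int) \<Rightarrow> nat \<Rightarrow> nat \<Rightarrow> ('e \<Rightarrow> int) \<Rightarrow> bool" where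
  "integer_circular_flow G \<tau> k d f \<longleftrightarrow>
     (\<forall>e \<in> edges G. int d \<le> \<bar>f e\<bar> \<and> \<bar>f e\<bar> \<le> int k - int d) \<and>
     (\<forall>v \<in> vertices G. boundary G \<tau> f v = 0)"

definition modulo_circular_flow ::
    "('v, 'e) multigraph \<Rightarrow> ('e \<times> bool \<Rightarrow> int) \<Rightarrow> nat \<Rightarrow> nat \<Rightarrow> ('e \<Rightarrow> int) \<Rightarrow> bool" where
  "modulo_circular_flow G \<tau> k d f \<longleftrightarrow>
     (\<forall>e \<in> edges G. int d \<le> \<bar>f e\<bar> \<and> \<bar>f e\<bar> \<le> int k - int d) \<and>
     (\<forall>v \<in> vertices G. [boundary G \<tau> f v = 0] (mod int k))"

end

theory Submission
  imports Defs Complex_Main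
begin

text \<open>
  Let \<open>f\<close> be a modulo flow and let \<open>Z h\<close> be the residue of \<open>- f(e\<^sub>h) \<tau>(h)\<close> modulo \<open>2p + 1\<close>, which is
  \<open>p\<close> or \<open>p + 1\<close>. The sum of \<open>Z\<close> over the half-edges at \<open>v\<close> is \<open>(2p + 1) N(v)\<close> for some natural
  number \<open>N(v)\<close>. If a set of half-edges contains exactly \<open>N(v)\<close> half-edges at each \<open>v\<close>, and both or
  none of the half-edges of an edge if their orientations agree, exactly one of them otherwise, then
  \<open>g(e\<^sub>h) \<tau>(h) = (2p + 1) q(h) - Z h\<close>, with \<open>q\<close> the indicator of the set, defines an integer flow.

  Such sets correspond to perfect matchings of an auxiliary graph, in which the numbers
  \<open>Z h / (2p + 1)\<close> provide a fractional perfect matching. By the Tutte--Berge formula it is enough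
  that every cut around an odd set of nodes has weight at least 1. This follows from a parity
  argument as soon as the graph has no bridge.
\<close>

section \<open>Perfect matchings from fractional ones\<close>

definition matching :: "'a set set \<Rightarrow> 'a set set \<Rightarrow> bool" where
  "matching E M \<longleftrightarrow> M \<subseteq> E \<and> pairwise disjnt M"

definition max_matching :: "'a set set \<Rightarrow> 'a set set \<Rightarrow> bool" where
  "max_matching E M \<longleftrightarrow> matching E M \<and> (\<forall>N. matching E N \<longrightarrow> card N \<le> card M)"

lemma max_matching_exists:
  assumes "finite E"
  obtains M where "max_matching E M"
proof -
  have "matching E {}" by (simp add: matching_def)
  moreover have "card M \<le> card E" if "matching E M" for M
    using that assms by (auto simp: matching_def intro: card_mono)
  then have "\<forall>M. matching E M \<longrightarrow> card M < Suc (card E)" by (simp add: le_imp_less_Suc)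
  ultimately obtain M where "matching E M" "\<forall>N. matching E N \<longrightarrow> card N \<le> card M"
    using ex_has_greatest_nat[of "matching E" "{}" card "Suc (card E)"] by blast
  then show thesis using that by (auto simp: max_matching_def)
qed

lemma card_Union_matching:
  assumes "finite E" "\<And>e. e \<in> E \<Longrightarrow> card e = 2" "matching E M"
  shows "finite M" "finite (\<Union>M)" "card (\<Union>M) = 2 * card M"
proof -
  have ME: "M \<subseteq> E" and d: "pairwise disjnt M" using assms(3) by (auto simp: matching_def)
  show fM: "finite M" using ME assms(1) finite_subset by blast
  have fe: "finite e" "card e = 2" if "e \<in> M" for e
    using assms(2)[of e] ME that card.infinite by fastforce+
  show "finite (\<Union>M)" using fM fe by auto
  show "card (\<Union>M) = 2 * card M"
    using card_Union_disjoint[OF d] fe by simp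
qed

lemma matching_insert:
  assumes "matching E M" "e \<in> E" "e \<inter> \<Union>M = {}"
  shows "matching E (insert e M)"
proof -
  have "disjnt e f" if "f \<in> M" for f using that assms(3) unfolding disjnt_def by blast
  then show ?thesis
    using assms(1,2) by (auto simp: matching_def pairwise_insert disjnt_sym)
qed

lemma max_matching_covers_edge:
  assumes "finite E" "\<And>e. e \<in> E \<Longrightarrow> card e = 2" "max_matching E M" "e \<in> E"
  shows "e \<inter> \<Union>M \<noteq> {}"
proof
  assume d: "e \<inter> \<Union>M = {}"
  have m: "matching E M" using assms(3) by (simp add: max_matching_def)
  have "e \<noteq> {}" using assms(2)[OF assms(4)] by auto
  then have "e \<notin> M" using d by auto
  then have "card (insert e M) = Suc (card M)"
    using card_Union_matching(1)[OF assms(1,2) m] by simp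
  moreover have "card (insert e M) \<le> card M"
    using matching_insert[OF m assms(4) d] assms(3) by (simp add: max_matching_def)
  ultimately show False by simp
qed

text \<open>
  Gallai's lemma: take maximum matchings \<open>M\<close> missing \<open>u\<close> and \<open>v\<close> and \<open>N\<close> missing \<open>t\<close> with largest
  overlap; exchanging an edge of \<open>N\<close> for one of \<open>M\<close> enlarges the overlap.
\<close>

lemma max_matching_misses_trans:
  assumes fin: "finite E" and two: "\<And>e. e \<in> E \<Longrightarrow> card e = 2"
    and t: "max_matching E T" "t \<notin> \<Union>T"
    and ut: "\<And>N. max_matching E N \<Longrightarrow> u \<in> \<Union>N \<or> t \<in> \<Union>N"
    and tv: "\<And>N. max_matching E N \<Longrightarrow> t \<in> \<Union>N \<or> v \<in> \<Union>N"
    and uv: "u \<noteq> v" and S: "max_matching E S"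
  shows "u \<in> \<Union>S \<or> v \<in> \<Union>S"
proof (rule ccontr)
  assume nS: "\<not> (u \<in> \<Union>S \<or> v \<in> \<Union>S)"
  define Q where "Q = (\<lambda>(M, N). max_matching E M \<and> max_matching E N \<and>
      u \<notin> \<Union>M \<and> v \<notin> \<Union>M \<and> t \<notin> \<Union>N)"
  have "Q (S, T)" using nS S t by (simp add: Q_def)
  moreover have "card (fst x \<inter> snd x) \<le> card E" if "Q x" for x
    using that fin by (auto simp: Q_def max_matching_def matching_def intro!: card_mono)
  then have "\<forall>x. Q x \<longrightarrow> card (fst x \<inter> snd x) < Suc (card E)" by (metis le_imp_less_Suc)
  ultimately obtain x where x: "Q x"
    and mx: "\<And>y. Q y \<Longrightarrow> card (fst y \<inter> snd y) \<le> card (fst x \<inter> snd x)"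
    using ex_has_greatest_nat[of Q "(S, T)" "\<lambda>x. card (fst x \<inter> snd x)" "Suc (card E)"] by blast
  obtain M N where xMN: "x = (M, N)" by (cases x)
  have M: "max_matching E M" and N: "max_matching E N"
    and uM: "u \<notin> \<Union>M" and vM: "v \<notin> \<Union>M" and tN: "t \<notin> \<Union>N"
    using x by (auto simp: Q_def xMN)
  have mM: "matching E M" and mN: "matching E N"
    using M N by (auto simp: max_matching_def)
  note cM = card_Union_matching[OF fin two mM] and cN = card_Union_matching[OF fin two mN]
  \<comment> \<open>\<open>M\<close> and \<open>N\<close> cover equally many vertices, and
    \<open>N\<close> covers \<open>u\<close> and \<open>v\<close>, both missed by \<open>M\<close>.
    So \<open>M\<close> covers at least two vertices missed by \<open>N\<close>, one of them
    different from \<open>t\<close>.\<close>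
  have "card M = card N" using M N by (simp add: max_matching_def le_antisym)
  then have "card (\<Union>M) = card (\<Union>N)" using cM cN by simp
  then have "card (\<Union>M - \<Union>N) = card (\<Union>N - \<Union>M)"
    using cM(2) cN(2) by (metis Int_commute card_Diff_subset_Int finite_Int)
  moreover have "{u, v} \<subseteq> \<Union>N - \<Union>M" using ut[OF N] tv[OF N] tN uM vM by blast
  then have "card {u, v} \<le> card (\<Union>N - \<Union>M)" by (rule card_mono[rotated]) (use cN(2) in auto)
  ultimately have "2 \<le> card (\<Union>M - \<Union>N)" using uv by simp
  then have "\<not> \<Union>M - \<Union>N \<subseteq> {t}"
    using card_mono[of "{t}" "\<Union>M - \<Union>N"] by auto
  then obtain x1 e where e: "e \<in> M" "x1 \<in> e" "x1 \<notin> \<Union>N" "x1 \<noteq> t" by blast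
  have eE: "e \<in> E" using mM e(1) by (auto simp: matching_def)
  obtain y where ey: "e = {x1, y}" "y \<noteq> x1"
    using two[OF eE] e(2) by (auto simp: card_2_iff)
  have "y \<in> \<Union>N" using max_matching_covers_edge[OF fin two N eE] ey e by auto
  then obtain f where f: "f \<in> N" "y \<in> f" by blast
  have fe: "f \<noteq> e" using f e by blast
  have eN: "e \<notin> N" using e by blast
  have fM: "f \<notin> M"
  proof
    assume "f \<in> M"
    then have "disjnt f e" using mM e(1) fe by (auto simp: matching_def pairwise_def)
    then show False using f(2) ey by (auto simp: disjnt_def)
  qed
  \<comment> \<open>\<open>x1\<close> differs from \<open>t\<close> and \<open>y\<close> was covered
    before, so \<open>N'\<close> still misses \<open>t\<close>. As \<open>f\<close> is not in
    \<open>M\<close>, the overlap with \<open>M\<close> gains \<open>e\<close> and loses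
    nothing.\<close>
  define N' where "N' = insert e (N - {f})"
  have yN: "y \<notin> \<Union>(N - {f})"
    using mN f by (auto simp: matching_def pairwise_def disjnt_def)
  have "matching E (N - {f})" using mN by (auto simp: matching_def pairwise_def)
  then have mN': "matching E N'"
    unfolding N'_def by (rule matching_insert) (use eE ey e yN in auto)
  have "card N' = card N" using eN card.remove[OF cN(1) f(1)] cN(1) by (simp add: N'_def)
  then have "max_matching E N'" using mN' N by (simp add: max_matching_def)
  moreover have "t \<notin> \<Union>N'" using tN e(4) ey \<open>y \<in> \<Union>N\<close> by (auto simp: N'_def)
  ultimately have "Q (M, N')" using M uM vM by (simp add: Q_def)
  then have "card (M \<inter> N') \<le> card (M \<inter> N)" using mx[of "(M, N')"] xMN by simp
  moreover have "M \<inter> N' = insert e (M \<inter> N)" using fM e(1) by (auto simp: N'_def)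
  then have "card (M \<inter> N') = Suc (card (M \<inter> N))" using eN cM(1) by simp
  ultimately show False by simp
qed

text \<open>
  The sets in \<open>\<C>\<close> play the role of the odd components of the graph without \<open>X\<close>; connectedness
  is irrelevant, all that matters is that edges leaving them end in \<open>X\<close>.
\<close>

definition barrier :: "'a set \<Rightarrow> 'a set set \<Rightarrow> 'a set \<Rightarrow> 'a set set \<Rightarrow> bool" where
  "barrier V E X \<C> \<longleftrightarrow> X \<subseteq> V \<and> pairwise disjnt \<C> \<and>
    (\<forall>C\<in>\<C>. C \<subseteq> V - X \<and> odd (card C) \<and> (\<forall>e\<in>E. e \<inter> C \<noteq> {} \<longrightarrow> e \<subseteq> C \<union> X))"

text \<open>Induction on the number of vertices. A vertex that no maximum matching misses is deleted
  and then added to \<open>X\<close>. If there is none, Gallai's lemma makes "no maximum matching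
  misses both" transitive, hence an equivalence relation up to reflexivity. No edge leaves a class,
  so \<open>X = {}\<close> works with the classes of the vertices missed by
  \<open>M\<close>.\<close>

lemma tutte_berge:
  assumes "finite V" "E \<subseteq> {e. e \<subseteq> V \<and> card e = 2}" "max_matching E M"
  shows "\<exists>X \<C>. barrier V E X \<C> \<and> card X + card V \<le> card \<C> + 2 * card M"
  using assms
proof (induction "card V" arbitrary: V E M rule: less_induct)
  case less
  have fE: "finite E" by (rule finite_subset[of _ "Pow V"]) (use less.prems(1,2) in auto)
  have two: "\<And>e. e \<in> E \<Longrightarrow> card e = 2" using less.prems(2) by auto
  have mM: "matching E M" using less.prems(3) by (simp add: max_matching_def)
  note cM = card_Union_matching[OF fE two mM]
  show ?case
  proof (cases "\<exists>v\<in>V. \<forall>N. max_matching E N \<longrightarrow> v \<in> \<Union>N")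
    case True
    then obtain v where v: "v \<in> V" "\<And>N. max_matching E N \<Longrightarrow> v \<in> \<Union>N" by blast
    define E' where "E' = {e \<in> E. v \<notin> e}"
    have E': "E' \<subseteq> {e. e \<subseteq> V - {v} \<and> card e = 2}" using less.prems(2) by (auto simp: E'_def)
    have "finite E'" using fE by (simp add: E'_def)
    then obtain M' where M': "max_matching E' M'" by (rule max_matching_exists)
    have m': "matching E M'" and "v \<notin> \<Union>M'"
      using M' by (auto simp: max_matching_def matching_def E'_def)
    then have "\<not> max_matching E M'" using v(2) by blast
    then have lt: "card M' < card M"
      using m' less.prems(3) by (meson leI max_matching_def order_trans)
    have cV: "card V = Suc (card (V - {v}))" using card.remove[OF less.prems(1) v(1)] .
    have "\<exists>X \<C>. barrier (V - {v}) E' X \<C> \<and> card X + card (V - {v}) \<le> card \<C> + 2 * card M'"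
      by (rule less.hyps) (use cV less.prems(1) E' M' in auto)
    then obtain X \<C> where b: "barrier (V - {v}) E' X \<C>"
      and ineq: "card X + card (V - {v}) \<le> card \<C> + 2 * card M'"
      by blast
    have X: "X \<subseteq> V - {v}" "pairwise disjnt \<C>"
      and C: "\<And>C. C \<in> \<C> \<Longrightarrow> C \<subseteq> V - {v} - X" "\<And>C. C \<in> \<C> \<Longrightarrow> odd (card C)"
        "\<And>C e. C \<in> \<C> \<Longrightarrow> e \<in> E' \<Longrightarrow> e \<inter> C \<noteq> {} \<Longrightarrow> e \<subseteq> C \<union> X"
      using b by (simp_all add: barrier_def)
    have fX: "finite X" by (rule finite_subset[of _ V]) (use X(1) less.prems(1) in auto)
    have cX: "card (insert v X) = Suc (card X)" using X(1) fX by (subst card_insert_disjoint) auto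
    have nb: "e \<subseteq> C \<union> insert v X" if h: "C \<in> \<C>" "e \<in> E" "e \<inter> C \<noteq> {}" for C e
    proof (cases "v \<in> e")
      case False
      then show ?thesis using C(3)[OF h(1) _ h(3)] h(2) by (auto simp: E'_def)
    next
      case True
      obtain w where w: "w \<in> e" "w \<in> C" using h(3) by blast
      have "w \<noteq> v" using w C(1)[OF h(1)] by blast
      then have "e = {v, w}" using two[OF h(2)] True w(1) by (auto simp: card_2_iff)
      then show ?thesis using w by auto
    qed
    \<comment> \<open>Both terms on the left grow by one; \<open>card M' < card M\<close> pays for
      this, since matching edges count twice.\<close>
    have "card (insert v X) + card V \<le> card \<C> + 2 * card M" using cX cV ineq lt by simp
    moreover have "insert v X \<subseteq> V" using X(1) v(1) by blast
    moreover have "C \<subseteq> V - insert v X" if "C \<in> \<C>" for C using C(1)[OF that] by blast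
    ultimately show ?thesis
      using X(2) C(2) nb by (intro exI[of _ "insert v X"] exI[of _ \<C>]) (simp add: barrier_def)
  next
    case False
    then have missed: "\<exists>N. max_matching E N \<and> v \<notin> \<Union>N" if "v \<in> V" for v using that by blast
    define R where "R u w \<longleftrightarrow> u = w \<or> (\<forall>N. max_matching E N \<longrightarrow> u \<in> \<Union>N \<or> w \<in> \<Union>N)" for u w
    have Rsym: "R u w \<Longrightarrow> R w u" for u w unfolding R_def by blast
    have Rtrans: "R u w" if h: "R u x" "R x w" "x \<in> V" for u x w
    proof (cases "u = w \<or> u = x \<or> x = w")
      case True
      then show ?thesis using h by (auto simp: R_def)
    next
      case False
      obtain T where T: "max_matching E T" "x \<notin> \<Union>T" using missed[OF h(3)] by blast
      have "u \<in> \<Union>S \<or> w \<in> \<Union>S" if "max_matching E S" for S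
        by (rule max_matching_misses_trans[OF fE two T])
          (use h(1,2) False that in \<open>auto simp: R_def\<close>)
      then show ?thesis unfolding R_def by blast
    qed
    have Redge: "R a b" if "{a, b} \<in> E" for a b
    proof -
      have "a \<in> \<Union>N \<or> b \<in> \<Union>N" if "max_matching E N" for N
        using max_matching_covers_edge[OF fE two that \<open>{a, b} \<in> E\<close>] by auto
      then show ?thesis unfolding R_def by blast
    qed
    define cls where "cls u = {w \<in> V. R u w}" for u
    have closed: "e \<subseteq> cls u" if h: "e \<in> E" "e \<inter> cls u \<noteq> {}" for e u
    proof
      fix b assume b: "b \<in> e"
      obtain a where a: "a \<in> e" "a \<in> V" "R u a" using h(2) by (auto simp: cls_def)
      have eV: "e \<subseteq> V" using h(1) less.prems(2) by auto
      show "b \<in> cls u"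
      proof (cases "a = b")
        case True
        then show ?thesis using a by (simp add: cls_def)
      next
        case ab: False
        then have "e = {a, b}" using two[OF h(1)] a(1) b by (auto simp: card_2_iff)
        then have "R a b" using h(1) Redge by blast
        then show ?thesis using Rtrans[OF a(3) _ a(2)] b eV by (auto simp: cls_def)
      qed
    qed
    define F where "F = V - \<Union>M"
    have MV: "\<Union>M \<subseteq> V" using mM less.prems(2) by (auto simp: matching_def)
    have cF: "card V = card F + 2 * card M"
      unfolding F_def using card_Diff_subset[OF cM(2) MV] card_mono[OF less.prems(1) MV] cM(3)
      by simp
    have Fneq: "\<not> R u w" if "u \<in> F" "w \<in> F" "u \<noteq> w" for u w
      using that less.prems(3) unfolding F_def R_def by blast
    have inj: "inj_on cls F"
    proof (rule inj_onI)
      fix u w assume uw: "u \<in> F" "w \<in> F" "cls u = cls w"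
      have "w \<in> cls w" using uw(2) by (auto simp: cls_def R_def F_def)
      then have "R u w" using uw(3) by (auto simp: cls_def)
      then show "u = w" using Fneq uw by blast
    qed
    \<comment> \<open>\<open>M\<close> misses \<open>u\<close> but no other vertex of the class, and
      its edges do not leave the class. So the class without \<open>u\<close> is perfectly
      matched.\<close>
    have odd: "odd (card (cls u))" if u: "u \<in> F" for u
    proof -
      define K where "K = {e \<in> M. e \<subseteq> cls u}"
      have mK: "matching E K" using mM by (auto simp: K_def matching_def pairwise_def)
      have "cls u - {u} \<subseteq> \<Union>K"
      proof
        fix w assume w: "w \<in> cls u - {u}"
        then have "w \<notin> F" using Fneq[OF u, of w] by (auto simp: cls_def)
        then obtain e where e: "e \<in> M" "w \<in> e" using w by (auto simp: cls_def F_def)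
        have "e \<subseteq> cls u" by (rule closed) (use e w mM in \<open>auto simp: matching_def\<close>)
        then show "w \<in> \<Union>K" using e by (auto simp: K_def)
      qed
      moreover have "u \<notin> \<Union>K" using u by (auto simp: K_def F_def)
      ultimately have "cls u = insert u (\<Union>K)" "u \<notin> \<Union>K"
        using u by (auto simp: K_def cls_def R_def F_def)
      then show ?thesis using card_Union_matching[OF fE two mK] by simp
    qed
    have disj: "pairwise disjnt (cls ` F)"
    proof (rule pairwiseI)
      fix A B assume A: "A \<in> cls ` F" "B \<in> cls ` F" "A \<noteq> B"
      then obtain a b where ab: "a \<in> F" "b \<in> F" "A = cls a" "B = cls b" by blast
      have "\<not> R a b" using Fneq ab A(3) by blast
      then have "\<not> (R a w \<and> R b w)" if "w \<in> V" for w using Rtrans[OF _ Rsym that] by blast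
      then show "disjnt A B" by (auto simp: disjnt_def ab cls_def)
    qed
    have "card {} + card V \<le> card (cls ` F) + 2 * card M" using card_image[OF inj] cF by simp
    moreover have "C \<subseteq> V" if "C \<in> cls ` F" for C using that by (auto simp: cls_def)
    ultimately show ?thesis
      using disj odd closed by (intro exI[of _ "{}"] exI[of _ "cls ` F"]) (auto simp: barrier_def)
  qed
qed

text \<open>Weak duality against a Tutte-Berge barrier: each member of \<open>\<C>\<close> has cut
  weight at least 1, all of it on links ending in \<open>X\<close>, and the degrees in
  \<open>X\<close> sum to at most \<open>card X\<close>. Hence
  \<open>card \<C> \<le> card X\<close>, and a maximum matching covers \<open>V\<close>. The index
  set \<open>I\<close> keeps the weights of parallel links apart; these arise when both half-edges
  of a loop share a node.\<close>

lemma perfect_matching_of_odd_cuts: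
  fixes w :: "'i \<Rightarrow> real" and s t :: "'i \<Rightarrow> 'a"
  assumes fV: "finite V" and fI: "finite I"
    and ends: "\<And>i. i \<in> I \<Longrightarrow> s i \<in> V \<and> t i \<in> V \<and> s i \<noteq> t i"
    and w: "\<And>i. i \<in> I \<Longrightarrow> 0 \<le> w i"
    and deg: "\<And>v. v \<in> V \<Longrightarrow> (\<Sum>i\<in>I. w i * (of_bool (s i = v) + of_bool (t i = v))) \<le> 1"
    and cut: "\<And>C. C \<subseteq> V \<Longrightarrow> odd (card C) \<Longrightarrow>
      1 \<le> (\<Sum>i\<in>I. w i * of_bool ((s i \<in> C) \<noteq> (t i \<in> C)))"
  obtains M where "matching ((\<lambda>i. {s i, t i}) ` I) M" "\<Union>M = V"
proof -
  define E where "E = (\<lambda>i. {s i, t i}) ` I"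
  have fE: "finite E" using fI by (simp add: E_def)
  have E: "E \<subseteq> {e. e \<subseteq> V \<and> card e = 2}" using ends by (auto simp: E_def)
  have two: "\<And>e. e \<in> E \<Longrightarrow> card e = 2" using E by auto
  obtain M where M: "max_matching E M" using max_matching_exists[OF fE] .
  then have mM: "matching E M" by (simp add: max_matching_def)
  note cM = card_Union_matching[OF fE two mM]
  have MV: "\<Union>M \<subseteq> V" using mM E by (auto simp: matching_def)
  obtain X \<C> where b: "barrier V E X \<C>"
    and ineq: "card X + card V \<le> card \<C> + 2 * card M"
    using tutte_berge[OF fV E M] by blast
  have X: "X \<subseteq> V" "pairwise disjnt \<C>"
    and C: "\<And>C. C \<in> \<C> \<Longrightarrow> C \<subseteq> V - X" "\<And>C. C \<in> \<C> \<Longrightarrow> odd (card C)"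
      "\<And>C e. C \<in> \<C> \<Longrightarrow> e \<in> E \<Longrightarrow> e \<inter> C \<noteq> {} \<Longrightarrow> e \<subseteq> C \<union> X"
    using b by (simp_all add: barrier_def)
  have fC: "finite \<C>" by (rule finite_subset[of _ "Pow V"]) (use C(1) fV in auto)
  have fX: "finite X" using X(1) fV finite_subset by blast
  have one: "(\<Sum>C\<in>\<C>. of_bool (x \<in> C)) \<le> (1::real)" for x
  proof -
    have "card {C \<in> \<C>. x \<in> C} \<le> 1"
      using X(2) by (auto simp: card_le_Suc0_iff_eq fC pairwise_def disjnt_def)
    moreover have "\<C> \<inter> {C. x \<in> C} = {C \<in> \<C>. x \<in> C}" by blast
    ultimately show ?thesis using fC by (simp add: sum_of_bool_eq)
  qed
  \<comment> \<open>A link crossing a member of \<open>\<C>\<close> has one end inside it and the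
    other in \<open>X\<close>; by disjointness each end lies in at most one member.\<close>
  have pt: "(\<Sum>C\<in>\<C>. of_bool ((s i \<in> C) \<noteq> (t i \<in> C)))
      \<le> (of_bool (s i \<in> X) + of_bool (t i \<in> X) :: real)" if i: "i \<in> I" for i
  proof -
    have "of_bool ((s i \<in> C) \<noteq> (t i \<in> C)) \<le>
        of_bool (s i \<in> C) * of_bool (t i \<in> X) + of_bool (t i \<in> C) * (of_bool (s i \<in> X) :: real)"
      if "C \<in> \<C>" for C
      using C(3)[OF that, of "{s i, t i}"] i by (auto simp: E_def)
    then have "(\<Sum>C\<in>\<C>. of_bool ((s i \<in> C) \<noteq> (t i \<in> C))) \<le>
        (\<Sum>C\<in>\<C>. of_bool (s i \<in> C) * of_bool (t i \<in> X) + of_bool (t i \<in> C) * (of_bool (s i \<in> X) :: real))"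
      by (rule sum_mono)
    also have "\<dots> = (\<Sum>C\<in>\<C>. of_bool (s i \<in> C)) * of_bool (t i \<in> X)
        + (\<Sum>C\<in>\<C>. of_bool (t i \<in> C)) * of_bool (s i \<in> X)"
      by (simp add: sum.distrib sum_distrib_right)
    also have "\<dots> \<le> of_bool (t i \<in> X) + of_bool (s i \<in> X)"
      using one[of "s i"] one[of "t i"] by (auto simp: of_bool_def)
    finally show ?thesis by simp
  qed
  have "real (card \<C>) = (\<Sum>C\<in>\<C>. 1)" by simp
  also have "\<dots> \<le> (\<Sum>C\<in>\<C>. \<Sum>i\<in>I. w i * of_bool ((s i \<in> C) \<noteq> (t i \<in> C)))"
    using C(1,2) by (intro sum_mono cut) auto
  also have "\<dots> = (\<Sum>i\<in>I. w i * (\<Sum>C\<in>\<C>. of_bool ((s i \<in> C) \<noteq> (t i \<in> C))))"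
    by (subst sum.swap) (simp add: sum_distrib_left)
  also have "\<dots> \<le> (\<Sum>i\<in>I. w i * (of_bool (s i \<in> X) + of_bool (t i \<in> X)))"
    using pt w by (intro sum_mono mult_left_mono) auto
  also have "\<dots> = (\<Sum>i\<in>I. \<Sum>x\<in>X. w i * (of_bool (s i = x) + of_bool (t i = x)))"
    using fX by (simp add: sum_distrib_left[symmetric] sum.distrib of_bool_def)
  also have "\<dots> = (\<Sum>x\<in>X. \<Sum>i\<in>I. w i * (of_bool (s i = x) + of_bool (t i = x)))"
    by (rule sum.swap)
  also have "\<dots> \<le> (\<Sum>x\<in>X. 1)" using X(1) by (intro sum_mono deg) auto
  finally have "card \<C> \<le> card X" by simp
  then have "card V \<le> card (\<Union>M)" using ineq cM by simp
  then have "\<Union>M = V" using card_seteq[OF fV MV] by simp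
  then show thesis using that mM by (simp add: E_def)
qed

section \<open>Selecting half-edges\<close>

text \<open>
  Contribution of an edge to the weight of a cut, multiplied by \<open>2 * p + 1\<close>: \<open>u1\<close>, \<open>u2\<close> record whether
  its ends lie on the inner side, \<open>n1\<close>, \<open>n2\<close> whether its half-edge nodes do. If its two half-edges
  share a node, then \<open>n1 = n2\<close>.
\<close>

definition edge_cut :: "bool \<Rightarrow> nat \<Rightarrow> nat \<Rightarrow> bool \<Rightarrow> bool \<Rightarrow> bool \<Rightarrow> bool \<Rightarrow> nat" where
  "edge_cut par z c u1 u2 n1 n2 = z * of_bool (u1 \<noteq> n1) +
     (if par then z else c) * of_bool (u2 \<noteq> n2) + (if par then c * of_bool (n1 \<noteq> n2) else 0)"

text \<open>Modulo 2, \<open>of_bool (a \<noteq> b)\<close> is \<open>of_bool a + of_bool b\<close>.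
  Expanding \<open>edge_cut\<close> this way, the coefficients at each node add up to
  \<open>z + c\<close>.\<close>

lemma edge_cut_parity:
  assumes "z + c = 2 * p + 1" "\<not> par \<Longrightarrow> n2 = n1"
  shows "even (z * of_bool u1 + (if par then z else c) * of_bool u2
    + (2 * p + 1) * (of_bool n1 + of_bool (par \<and> n2)) + edge_cut par z c u1 u2 n1 n2)"
  using assms unfolding edge_cut_def
  by (cases par; cases u1; cases u2; cases n1; cases n2; simp; presburger)

text \<open>The ends of the edge are joined by a path through its nodes. If they lie on different
  sides, some link of the path is cut, and both \<open>z\<close> and \<open>c\<close> are at least
  \<open>p\<close>.\<close>

lemma edge_cut_crossing_ge:
  assumes "z + c = 2 * p + 1" "z = p \<or> z = p + 1" "\<not> par \<Longrightarrow> n2 = n1" "u1 \<noteq> u2"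
  shows "p \<le> edge_cut par z c u1 u2 n1 n2"
  using assms unfolding edge_cut_def
  by (cases par; cases u1; cases u2; cases n1; cases n2; simp; linarith)

text \<open>With both ends on the same side, the path through the nodes is cut an even number of
  times, so the possible values are 0, \<open>2 * z\<close> and \<open>z + c\<close>. Only the last
  is odd.\<close>

lemma edge_cut_noncrossing_ge:
  assumes "z + c = 2 * p + 1" "\<not> par \<Longrightarrow> n2 = n1" "odd (edge_cut par z c u u n1 n2)"
  shows "2 * p + 1 \<le> edge_cut par z c u u n1 n2"
  using assms unfolding edge_cut_def
  by (cases par; cases u; cases n1; cases n2; simp)

text \<open>What the matching argument retains of a modulo flow: \<open>P e\<close> stands for equal
  orientation values on the two half-edges of \<open>e\<close>, and \<open>Z\<close> for the
  residues.\<close>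

locale half_edge_weights =
  fixes G :: "('v, 'e) multigraph" and p :: nat and Z :: "'e \<times> bool \<Rightarrow> nat"
    and P :: "'e \<Rightarrow> bool" and N :: "'v \<Rightarrow> nat"
  assumes p_pos: "p > 0"
    and fin: "finite_multigraph G"
    and Z_cases: "\<And>h. h \<in> half_edges G \<Longrightarrow> Z h = p \<or> Z h = p + 1"
    and Z_eq: "\<And>e. e \<in> edges G \<Longrightarrow> P e \<Longrightarrow> Z (e, True) = Z (e, False)"
    and Z_sum: "\<And>e. e \<in> edges G \<Longrightarrow> \<not> P e \<Longrightarrow> Z (e, False) + Z (e, True) = 2 * p + 1"
    and N: "\<And>v. v \<in> vertices G \<Longrightarrow> (2 * p + 1) * N v = (\<Sum>h\<in>half_edges_at G v. Z h)"
    and bridgeless: "\<And>U e.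
      {e' \<in> edges G. (endpoint G (e', False) \<in> U) \<noteq> (endpoint G (e', True) \<in> U)} \<noteq> {e}"
begin

text \<open>
  The auxiliary graph has \<open>N v\<close> core nodes \<open>Inl (v, i)\<close> per vertex. An edge with \<open>P e\<close> gets a node for
  each half-edge, and these two are linked; otherwise its half-edges share one node. Nodes of
  half-edges are linked to all cores at their endpoint, and a half-edge is selected when its node
  is matched to a core.
\<close>

definition node :: "'e \<times> bool \<Rightarrow> 'e \<times> bool" where
  "node h = (if P (fst h) then h else (fst h, False))"

definition nodes :: "('v \<times> nat + 'e \<times> bool) set" where
  "nodes = (SIGMA v:vertices G. {..<N v}) <+> node ` half_edges G"

definition links :: "(('e \<times> bool) \<times> nat + 'e) set" where
  "links = (SIGMA h:half_edges G. {..<N (endpoint G h)}) <+> {e \<in> edges G. P e}"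

definition src :: "('e \<times> bool) \<times> nat + 'e \<Rightarrow> 'v \<times> nat + 'e \<times> bool" where
  "src l = (case l of Inl (h, i) \<Rightarrow> Inl (endpoint G h, i) | Inr e \<Rightarrow> Inr (e, False))"

definition tgt :: "('e \<times> bool) \<times> nat + 'e \<Rightarrow> 'v \<times> nat + 'e \<times> bool" where
  "tgt l = (case l of Inl (h, i) \<Rightarrow> Inr (node h) | Inr e \<Rightarrow> Inr (e, True))"

section \<open>The fractional perfect matching\<close>

definition share :: "'e \<times> bool \<Rightarrow> real" where
  "share h = real (Z h) / real (2 * p + 1)"

text \<open>The share of a half-edge is spread evenly over the cores at its endpoint. The link
  between two half-edge nodes carries what they lack to reach total weight 1.\<close>

definition weight :: "('e \<times> bool) \<times> nat + 'e \<Rightarrow> real" where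
  "weight l = (case l of Inl (h, i) \<Rightarrow> share h / N (endpoint G h) | Inr e \<Rightarrow> 1 - share (e, False))"

section \<open>Sums over half-edges, shares and links\<close>

lemma finite_edges: "finite (edges G)"
  and finite_vertices: "finite (vertices G)"
  and finite_half_edges: "finite (half_edges G)"
  using fin by (auto simp: finite_multigraph_def half_edges_def)

lemma finite_half_edges_at: "finite (half_edges_at G v)"
  using finite_half_edges by (auto simp: half_edges_at_def)

lemma endpoint_in: "h \<in> half_edges G \<Longrightarrow> endpoint G h \<in> vertices G"
  using fin by (auto simp: finite_multigraph_def)

lemma half_edge_iff: "(e, b) \<in> half_edges G \<longleftrightarrow> e \<in> edges G"
  by (simp add: half_edges_def)

lemma sum_half_edges: "(\<Sum>h\<in>half_edges G. g h) = (\<Sum>e\<in>edges G. g (e, False) + g (e, True))"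
  for g :: "'e \<times> bool \<Rightarrow> 'b::comm_monoid_add"
  using sum.cartesian_product[of "\<lambda>e b. g (e, b)" UNIV "edges G", symmetric]
  by (simp add: half_edges_def UNIV_bool add.commute)

lemma sum_half_edges_at:
  "(\<Sum>v\<in>vertices G. \<Sum>h\<in>half_edges_at G v. g h) = (\<Sum>h\<in>half_edges G. g h)"
  for g :: "'e \<times> bool \<Rightarrow> 'b::comm_monoid_add"
  unfolding half_edges_at_def
  by (rule sum.group) (use finite_half_edges finite_vertices endpoint_in in auto)

lemma Z_pos: "h \<in> half_edges G \<Longrightarrow> 0 < Z h"
  using Z_cases[of h] p_pos by auto

lemma Z_le: "h \<in> half_edges G \<Longrightarrow> Z h \<le> 2 * p + 1"
  using Z_cases[of h] by auto

lemma N_pos: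
  assumes "h \<in> half_edges G"
  shows "0 < N (endpoint G h)"
proof -
  have "h \<in> half_edges_at G (endpoint G h)" using assms by (simp add: half_edges_at_def)
  then have "Z h \<le> (\<Sum>h\<in>half_edges_at G (endpoint G h). Z h)"
    using finite_half_edges_at by (auto intro: member_le_sum)
  then show ?thesis using N[OF endpoint_in[OF assms]] Z_pos[OF assms] by (cases "N (endpoint G h)") auto
qed

lemma share_nonneg: "0 \<le> share h"
  by (simp add: share_def)

lemma share_le_1: "h \<in> half_edges G \<Longrightarrow> share h \<le> 1"
  unfolding share_def using of_nat_mono[OF Z_le, of h, where 'a = real] by (simp add: divide_le_eq)

lemma share_eq: "e \<in> edges G \<Longrightarrow> P e \<Longrightarrow> share (e, True) = share (e, False)"
  by (simp add: share_def Z_eq)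

lemma share_sum:
  assumes "e \<in> edges G" "\<not> P e"
  shows "share (e, False) + share (e, True) = 1"
  unfolding share_def add_divide_distrib[symmetric] of_nat_add[symmetric] Z_sum[OF assms]
  by (simp del: of_nat_add of_nat_mult)

lemma sum_share:
  assumes "v \<in> vertices G"
  shows "(\<Sum>h\<in>half_edges_at G v. share h) = N v"
  unfolding share_def sum_divide_distrib[symmetric] of_nat_sum[symmetric] N[OF assms, symmetric] of_nat_mult
  by (simp del: of_nat_add of_nat_mult)

lemma sum_links:
  "(\<Sum>l\<in>links. g l) = (\<Sum>h\<in>half_edges G. \<Sum>i<N (endpoint G h). g (Inl (h, i)))
    + (\<Sum>e | e \<in> edges G \<and> P e. g (Inr e))"
  for g :: "_ \<Rightarrow> real"
  unfolding links_def
  by (subst sum.Plus) (use finite_half_edges finite_edges in \<open>simp_all add: sum.Sigma split_def\<close>)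

lemma weight_nonneg: "l \<in> links \<Longrightarrow> 0 \<le> weight l"
  using share_nonneg share_le_1 by (auto simp: links_def weight_def half_edge_iff)

lemma node_image_iff: "(e, b) \<in> node ` half_edges G \<longleftrightarrow> e \<in> edges G \<and> (P e \<or> \<not> b)"
proof
  assume "e \<in> edges G \<and> (P e \<or> \<not> b)"
  then have "(e, b) = node (e, b)" "(e, b) \<in> half_edges G" by (auto simp: node_def half_edge_iff)
  then show "(e, b) \<in> node ` half_edges G" by (rule image_eqI)
qed (auto simp: node_def half_edge_iff split: if_splits)

lemma Inl_in_nodes_iff: "Inl (v, i) \<in> nodes \<longleftrightarrow> v \<in> vertices G \<and> i < N v"
  by (auto simp: nodes_def)

lemma Inr_in_nodes_iff: "Inr (e, b) \<in> nodes \<longleftrightarrow> e \<in> edges G \<and> (P e \<or> \<not> b)"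
  using node_image_iff by (auto simp: nodes_def)

lemma ends_in_nodes: "l \<in> links \<Longrightarrow> src l \<in> nodes \<and> tgt l \<in> nodes \<and> src l \<noteq> tgt l"
  using endpoint_in
  by (auto simp: links_def src_def tgt_def nodes_def node_image_iff half_edge_iff)

lemma finite_nodes: "finite nodes" and finite_links: "finite links"
  using finite_vertices finite_half_edges finite_edges by (auto simp: nodes_def links_def)

text \<open>The weights at a node in fact add up to exactly 1. At a core of \<open>v\<close> this
  holds because the shares at \<open>v\<close> sum to \<open>N v\<close>. At a half-edge node either
  one share meets its complement, or two shares are complementary.\<close>

lemma degree:
  assumes "x \<in> nodes"
  shows "(\<Sum>l\<in>links. weight l * (of_bool (src l = x) + of_bool (tgt l = x))) \<le> 1"
proof (cases x)
  case (Inl c)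
  then obtain v i where vi: "x = Inl (v, i)" "v \<in> vertices G" "i < N v"
    using assms by (auto simp: nodes_def)
  have "(\<Sum>l\<in>links. weight l * (of_bool (src l = x) + of_bool (tgt l = x)))
      = (\<Sum>h\<in>half_edges G. of_bool (endpoint G h = v) * (share h / N v))"
    unfolding sum_links
    by (auto simp: vi src_def tgt_def weight_def of_bool_def if_distrib[of "\<lambda>x. _ * x"] vi(3)
        cong: if_cong intro!: sum.cong)
  also have "\<dots> = (\<Sum>h\<in>half_edges_at G v. share h / N v)"
    unfolding half_edges_at_def
    by (subst sum.inter_filter) (auto intro!: sum.cong simp: finite_half_edges)
  also have "\<dots> = 1"
    unfolding sum_divide_distrib[symmetric] sum_share[OF vi(2)] using vi(3) by simp
  finally show ?thesis by simp
next
  case (Inr y)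
  then obtain e b where y: "y = node (e, b)" "e \<in> edges G"
    using assms by (auto simp: nodes_def half_edges_def)
  have "(\<Sum>l\<in>links. weight l * (of_bool (src l = x) + of_bool (tgt l = x)))
      = (\<Sum>h\<in>half_edges G. of_bool (node h = y) * share h)
        + (\<Sum>e' | e' \<in> edges G \<and> P e'. (1 - share (e', False)) *
            (of_bool ((e', False) = y) + of_bool ((e', True) = y)))"
    unfolding sum_links using N_pos
    by (intro arg_cong2[of _ _ _ _ "(+)"] sum.cong)
      (auto simp: Inr src_def tgt_def weight_def of_bool_def)
  \<comment> \<open>Among the links between half-edge nodes only that of \<open>e\<close> can end in
    \<open>y\<close>, and it exists just when \<open>P e\<close>.\<close>
  also have "(\<Sum>e' | e' \<in> edges G \<and> P e'. (1 - share (e', False)) *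
            (of_bool ((e', False) = y) + of_bool ((e', True) = y)))
      = (\<Sum>e'\<in>edges G. of_bool (e' = e) * (of_bool (P e) * (1 - share (e, False))))"
    by (subst sum.inter_filter, simp add: finite_edges, rule sum.cong)
      (auto simp: y node_def of_bool_def)
  also have "\<dots> = of_bool (P e) * (1 - share (e, False))"
    using y(2) finite_edges by (simp add: of_bool_def if_distrib[of "\<lambda>x. x * _"] cong: if_cong)
  also have "(\<Sum>h\<in>half_edges G. of_bool (node h = y) * share h)
      = (\<Sum>e'\<in>edges G. of_bool (e' = e) *
          (if P e then share (e, b) else share (e, False) + share (e, True)))"
    unfolding sum_half_edges
    by (rule sum.cong) (cases b; auto simp: y node_def of_bool_def)+
  also have "\<dots> = (if P e then share (e, b) else share (e, False) + share (e, True))"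
    using y(2) finite_edges by (simp add: of_bool_def if_distrib[of "\<lambda>x. x * _"] cong: if_cong)
  also have "\<dots> + of_bool (P e) * (1 - share (e, False)) = 1"
    using share_eq[OF y(2)] share_sum[OF y(2)] by (cases b) auto
  finally show ?thesis by simp
qed

text \<open>A half-edge has equal weight towards all cores at its endpoint, so only the number
  \<open>a v\<close> of cores inside \<open>C\<close> matters.\<close>

lemma cut_weight:
  fixes C
  defines "a v \<equiv> card {i. i < N v \<and> Inl (v, i) \<in> C}"
  shows "(\<Sum>l\<in>links. weight l * of_bool ((src l \<in> C) \<noteq> (tgt l \<in> C))) =
    (\<Sum>h\<in>half_edges G. share h / N (endpoint G h) *
        (if Inr (node h) \<in> C then real (N (endpoint G h)) - a (endpoint G h) else a (endpoint G h)))
    + (\<Sum>e | e \<in> edges G \<and> P e. (1 - share (e, False)) *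
        of_bool (((Inr (e, False)) \<in> C) \<noteq> (Inr (e, True) \<in> C)))"
proof -
  have inn: "(\<Sum>i<N v. of_bool ((Inl (v, i) \<in> C) \<noteq> B)) = (if B then real (N v) - a v else a v)" for v B
  proof -
    have "{..<N v} \<inter> {i. Inl (v, i) \<in> C} = {i. i < N v \<and> Inl (v, i) \<in> C}" by auto
    then have 1: "(\<Sum>i<N v. of_bool (Inl (v, i) \<in> C)) = real (a v)"
      by (simp add: a_def sum_of_bool_eq)
    have "(\<Sum>i<N v. of_bool (Inl (v, i) \<notin> C)) = (\<Sum>i<N v. 1 - of_bool (Inl (v, i) \<in> C) :: real)"
      by (rule sum.cong) auto
    then show ?thesis using 1 by (simp add: sum_subtractf)
  qed
  show ?thesis
    unfolding sum_links
    by (simp add: weight_def src_def tgt_def inn[symmetric] sum_distrib_left del: sum_of_bool_eq sum_of_bool_mult_eq sum_mult_of_bool_eq)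
qed

text \<open>If \<open>v\<close> has cores on both sides, each half-edge at \<open>v\<close> has a
  core of \<open>v\<close> opposite its node and so contributes at least
  \<open>share h / N v\<close>. These bounds add up to 1.\<close>

lemma cut_weight_split_core:
  fixes C
  defines "a v \<equiv> card {i. i < N v \<and> Inl (v, i) \<in> C}"
  assumes v: "v \<in> vertices G" and av: "0 < a v" "a v < N v"
  shows "1 \<le> (\<Sum>l\<in>links. weight l * of_bool ((src l \<in> C) \<noteq> (tgt l \<in> C)))"
proof -
  define g where "g h = share h / N (endpoint G h) *
        (if Inr (node h) \<in> C then real (N (endpoint G h)) - a (endpoint G h) else a (endpoint G h))" for h
  have aN: "a x \<le> N x" for x
  proof -
    have "card {i. i < N x \<and> Inl (x, i) \<in> C} \<le> card {..<N x}" by (rule card_mono) auto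
    then show ?thesis by (simp add: a_def)
  qed
  have g0: "0 \<le> g h" for h using aN[of "endpoint G h"] by (simp add: g_def share_nonneg)
  have "1 = (\<Sum>h\<in>half_edges_at G v. share h / N v)"
    unfolding sum_divide_distrib[symmetric] sum_share[OF v] using av by simp
  also have "\<dots> \<le> (\<Sum>h\<in>half_edges_at G v. g h)"
  proof (rule sum_mono)
    fix h assume "h \<in> half_edges_at G v"
    then have hv: "endpoint G h = v" by (simp add: half_edges_at_def)
    have "1 \<le> (if Inr (node h) \<in> C then real (N v) - a v else a v)" using av by auto
    from mult_left_mono[OF this, of "share h / N v"]
    show "share h / N v \<le> g h" using share_nonneg unfolding g_def hv by simp
  qed
  also have "\<dots> \<le> (\<Sum>h\<in>half_edges G. g h)"
    by (rule sum_mono2) (use finite_half_edges g0 in \<open>auto simp: half_edges_at_def\<close>)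
  also have "\<dots> \<le> (\<Sum>h\<in>half_edges G. g h) + (\<Sum>e | e \<in> edges G \<and> P e. (1 - share (e, False)) *
        of_bool (((Inr (e, False)) \<in> C) \<noteq> (Inr (e, True) \<in> C)))"
  proof -
    have "0 \<le> (\<Sum>e | e \<in> edges G \<and> P e. (1 - share (e, False)) *
        of_bool (((Inr (e, False)) \<in> C) \<noteq> (Inr (e, True) \<in> C)))"
      using share_le_1 by (intro sum_nonneg mult_nonneg_nonneg) (auto simp: half_edge_iff)
    then show ?thesis by simp
  qed
  finally show ?thesis unfolding cut_weight g_def a_def .
qed

text \<open>
  If every vertex has all or none of its cores in \<open>C\<close>, the weight of the cut is an odd multiple of
  \<open>1 / (2 * p + 1)\<close> and every edge crossing the induced vertex cut contributes at least
  \<open>p / (2 * p + 1)\<close>; two crossing edges suffice by parity, three by size, and one would be a bridge.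
\<close>

lemma odd_cut_weight:
  assumes C: "C \<subseteq> nodes" "odd (card C)"
  shows "1 \<le> (\<Sum>l\<in>links. weight l * of_bool ((src l \<in> C) \<noteq> (tgt l \<in> C)))"
proof (cases "\<exists>v\<in>vertices G. 0 < card {i. i < N v \<and> Inl (v, i) \<in> C} \<and>
    card {i. i < N v \<and> Inl (v, i) \<in> C} < N v")
  case True
  then show ?thesis using cut_weight_split_core by blast
next
  case False
  define a where "a v = card {i. i < N v \<and> Inl (v, i) \<in> C}" for v
  define U where "U = {v. a v \<noteq> 0}"
  define u where "u h \<longleftrightarrow> endpoint G h \<in> U" for h
  define n where "n h \<longleftrightarrow> Inr (node h) \<in> C" for h
  have aN: "a v = (if v \<in> U then N v else 0)" if "v \<in> vertices G" for v
  proof -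
    have "card {i. i < N v \<and> Inl (v, i) \<in> C} \<le> card {..<N v}" by (rule card_mono) auto
    then show ?thesis using False that by (auto simp: a_def U_def)
  qed
  define c where "c e = 2 * p + 1 - Z (e, False)" for e
  define k where "k e = edge_cut (P e) (Z (e, False)) (c e)
    (u (e, False)) (u (e, True)) (n (e, False)) (n (e, True))" for e
  \<comment> \<open>The amount that \<open>e\<close> contributes to
    \<open>(2 * p + 1) * card C\<close>: cores are charged to half-edges through the equation for
    \<open>N\<close>, half-edge nodes to their own edge. As \<open>r e\<close> and
    \<open>k e\<close> have the same parity, the total of \<open>k\<close> is odd.\<close>
  define r where "r e = Z (e, False) * of_bool (u (e, False)) + Z (e, True) * of_bool (u (e, True))
    + (2 * p + 1) * (of_bool (Inr (e, False) \<in> C) + of_bool (Inr (e, True) \<in> C))" for e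
  have ZF: "Z (e, False) = p \<or> Z (e, False) = p + 1" if "e \<in> edges G" for e
    using Z_cases that by (simp add: half_edge_iff)
  have Zc: "Z (e, False) + c e = 2 * p + 1" if "e \<in> edges G" for e
    using ZF[OF that] by (auto simp: c_def)
  have ZT: "Z (e, True) = (if P e then Z (e, False) else c e)"
    if "e \<in> edges G" for e using Z_eq[OF that] Z_sum[OF that] Zc[OF that] by auto
  have nT: "n (e, True) = n (e, False)" if "\<not> P e" for e using that by (simp add: n_def node_def)

  have share_c: "1 - share (e, False) = c e / (2 * p + 1)" if "e \<in> edges G" for e
    using arg_cong[OF Zc[OF that], of real] by (simp add: share_def field_simps)
  have "(\<Sum>l\<in>links. weight l * of_bool ((src l \<in> C) \<noteq> (tgt l \<in> C))) =
      (\<Sum>h\<in>half_edges G. share h * of_bool (u h \<noteq> n h))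
      + (\<Sum>e | e \<in> edges G \<and> P e. (1 - share (e, False)) *
        of_bool (n (e, False) \<noteq> n (e, True)))"
    unfolding cut_weight a_def[symmetric]
    by (intro arg_cong2[of _ _ _ _ "(+)"] sum.cong)
      (use endpoint_in N_pos in \<open>auto simp: aN u_def n_def node_def\<close>)
  also have "\<dots> = (\<Sum>e\<in>edges G. share (e, False) * of_bool (u (e, False) \<noteq> n (e, False))
      + share (e, True) * of_bool (u (e, True) \<noteq> n (e, True))
      + (if P e then (1 - share (e, False)) * of_bool (n (e, False) \<noteq> n (e, True)) else 0))"
    unfolding sum_half_edges sum.inter_filter[OF finite_edges] sum.distrib ..
  also have "\<dots> = (\<Sum>e\<in>edges G. k e / (2 * p + 1))"
  proof (rule sum.cong)
    fix e assume e: "e \<in> edges G"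
    show "share (e, False) * of_bool (u (e, False) \<noteq> n (e, False))
      + share (e, True) * of_bool (u (e, True) \<noteq> n (e, True))
      + (if P e then (1 - share (e, False)) * of_bool (n (e, False) \<noteq> n (e, True)) else 0)
      = k e / (2 * p + 1)"
      unfolding share_c[OF e] unfolding share_def k_def edge_cut_def ZT[OF e]
      by (simp add: add_divide_distrib)
  qed simp
  also have "\<dots> = real (\<Sum>e\<in>edges G. k e) / (2 * p + 1)"
    by (simp add: sum_divide_distrib)
  finally have weight_k: "(\<Sum>l\<in>links. weight l * of_bool ((src l \<in> C) \<noteq> (tgt l \<in> C)))
    = real (\<Sum>e\<in>edges G. k e) / (2 * p + 1)" .

  have cardC: "card C = (\<Sum>v\<in>vertices G. a v)
      + (\<Sum>e\<in>edges G. of_bool (Inr (e, False) \<in> C) + of_bool (Inr (e, True) \<in> C))"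
  proof -
    define A B where "A = (SIGMA v:vertices G. {i. i < N v \<and> Inl (v, i) \<in> C})"
      and "B = (SIGMA e:edges G. {b. Inr (e, b) \<in> C})"
    have "x \<in> C \<longleftrightarrow> x \<in> A <+> B" for x
    proof (cases x)
      case (Inl c)
      then show ?thesis
        using subsetD[OF C(1), of x] by (cases c) (auto simp: A_def Inl_in_nodes_iff)
    next
      case (Inr c)
      then show ?thesis
        using subsetD[OF C(1), of x] by (cases c) (auto simp: B_def Inr_in_nodes_iff)
    qed
    then have CAB: "C = A <+> B" by blast
    have fAB: "finite A" "finite B" using finite_vertices finite_edges
      by (auto simp: A_def B_def intro!: finite_SigmaI)
    have "card {b. Inr (e, b) \<in> C} = of_bool (Inr (e, False) \<in> C) + of_bool (Inr (e, True) \<in> C)" for e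
    proof -
      have "{b. Inr (e, b) \<in> C} = (if Inr (e, False) \<in> C then {False} else {}) \<union>
          (if Inr (e, True) \<in> C then {True} else {})" by (auto, metis+)
      then show ?thesis by auto
    qed
    then have "card B = (\<Sum>e\<in>edges G. of_bool (Inr (e, False) \<in> C) + of_bool (Inr (e, True) \<in> C))"
      using finite_edges by (simp add: B_def)
    moreover have "card A = (\<Sum>v\<in>vertices G. a v)"
      using finite_vertices by (simp add: A_def a_def)
    ultimately show ?thesis using fAB by (simp add: CAB card_Plus)
  qed
  have "(2 * p + 1) * (\<Sum>v\<in>vertices G. a v) =
      (\<Sum>v\<in>vertices G. \<Sum>h\<in>half_edges_at G v. Z h * of_bool (u h))"
    unfolding sum_distrib_left
  proof (rule sum.cong)
    fix v assume v: "v \<in> vertices G"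
    have "(\<Sum>h\<in>half_edges_at G v. Z h * of_bool (u h)) = (\<Sum>h\<in>half_edges_at G v. Z h) * of_bool (v \<in> U)"
      unfolding sum_distrib_right by (rule sum.cong) (auto simp: half_edges_at_def u_def)
    then show "(2 * p + 1) * a v = (\<Sum>h\<in>half_edges_at G v. Z h * of_bool (u h))"
      using N[OF v] aN[OF v] by simp
  qed simp
  then have "(2 * p + 1) * card C = (\<Sum>e\<in>edges G. r e)"
    unfolding cardC sum_half_edges_at sum_half_edges
    by (simp add: r_def sum.distrib distrib_left sum_distrib_left)
  moreover have "even (r e + k e)" if e: "e \<in> edges G" for e
  proof -
    have "Inr (e, False) \<in> C \<longleftrightarrow> n (e, False)" by (simp add: n_def node_def)
    moreover have "Inr (e, True) \<in> C \<longleftrightarrow> P e \<and> n (e, True)"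
      using C(1) Inr_in_nodes_iff[of e True] by (auto simp: n_def node_def)
    ultimately show ?thesis
      unfolding r_def k_def ZT[OF e] using edge_cut_parity[OF Zc[OF e] nT] by simp
  qed
  then have "even (\<Sum>e\<in>edges G. r e + k e)" by (rule dvd_sum)
  ultimately have "even ((2 * p + 1) * card C + (\<Sum>e\<in>edges G. k e))" by (simp add: sum.distrib)
  then have oddk: "odd (\<Sum>e\<in>edges G. k e)" using C(2) by simp

  define X where "X = {e \<in> edges G. u (e, False) \<noteq> u (e, True)}"
  have fX: "finite X" using finite_edges by (simp add: X_def)
  have "card X \<noteq> 1"
  proof
    assume "card X = 1"
    then obtain e where "X = {e}" by (auto simp: card_1_singleton_iff)
    then show False using bridgeless[of U e] by (simp add: X_def u_def)
  qed
  have kX: "p \<le> k e" if "e \<in> X" for e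
    unfolding k_def by (rule edge_cut_crossing_ge) (use that Zc ZF nT in \<open>auto simp: X_def\<close>)
  have ge: "card X * p \<le> (\<Sum>e\<in>edges G. k e)"
  proof -
    have "card X * p \<le> (\<Sum>e\<in>X. k e)" using sum_bounded_below[of X p k] kX by simp
    also have "\<dots> \<le> (\<Sum>e\<in>edges G. k e)"
      by (rule sum_mono2) (use finite_edges in \<open>auto simp: X_def\<close>)
    finally show ?thesis .
  qed
  have "2 * p + 1 \<le> (\<Sum>e\<in>edges G. k e)"
  proof -
    consider "card X = 0" | "card X = 2" | "card X \<ge> 3" using \<open>card X \<noteq> 1\<close> by linarith
    then show ?thesis
    proof cases
      case 1
      \<comment> \<open>An odd total has an odd term, and an edge that does not cross with an odd
        term already supplies \<open>2 * p + 1\<close>.\<close>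
      then have X0: "X = {}" using fX by simp
      obtain e where e: "e \<in> edges G" "odd (k e)" using oddk by (meson dvd_sum)
      then have "u (e, False) = u (e, True)" using X0 by (auto simp: X_def)
      then have "2 * p + 1 \<le> k e"
        using edge_cut_noncrossing_ge[OF Zc[OF e(1)] nT] e(2) by (simp add: k_def)
      also have "\<dots> \<le> (\<Sum>e\<in>edges G. k e)"
        using e(1) finite_edges by (auto intro: member_le_sum)
      finally show ?thesis .
    next
      case 2
      then have "2 * p \<le> (\<Sum>e\<in>edges G. k e)" using ge by simp
      moreover have "2 * p \<noteq> (\<Sum>e\<in>edges G. k e)" using oddk by (metis dvd_triv_left)
      ultimately show ?thesis by simp
    next
      case 3
      \<comment> \<open>\<open>3 * p \<ge> 2 * p + 1\<close> because
        \<open>p \<ge> 1\<close>.\<close>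
      then have "3 * p \<le> card X * p" by simp
      then show ?thesis using ge p_pos by linarith
    qed
  qed
  then have "real (2 * p + 1) \<le> real (\<Sum>e\<in>edges G. k e)" by (rule of_nat_mono)
  then show ?thesis unfolding weight_k by (simp add: field_simps)
qed

text \<open>In a perfect matching the two nodes of an edge with \<open>P e\<close> are matched
  either to each other or both to cores. A shared node is always matched to a core, which selects
  one of its half-edges. Every core is used once, so \<open>N v\<close> half-edges are selected at
  \<open>v\<close>.\<close>

lemma selection_exists:
  obtains q where "\<And>e. e \<in> edges G \<Longrightarrow> P e \<Longrightarrow> q (e, True) = q (e, False)"
    and "\<And>e. e \<in> edges G \<Longrightarrow> \<not> P e \<Longrightarrow> q (e, True) = (\<not> q (e, False))"
    and "\<And>v. v \<in> vertices G \<Longrightarrow> card {h \<in> half_edges_at G v. q h} = N v"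
proof -
  obtain M where M: "matching ((\<lambda>l. {src l, tgt l}) ` links) M" and cover: "\<Union>M = nodes"
    by (rule perfect_matching_of_odd_cuts[of nodes links src tgt weight])
      (use finite_nodes finite_links ends_in_nodes weight_nonneg degree odd_cut_weight in auto)
  have uniq: "m = m'" if "m \<in> M" "m' \<in> M" "x \<in> m" "x \<in> m'" for m m' x
    using M that by (auto simp: matching_def pairwise_def disjnt_def)
  have M_cases: "(\<exists>h i. h \<in> half_edges G \<and> m = {Inl (endpoint G h, i), Inr (node h)}) \<or>
      (\<exists>e. P e \<and> m = {Inr (e, False), Inr (e, True)})" if "m \<in> M" for m
  proof -
    obtain l where l: "l \<in> links" "m = {src l, tgt l}" using M \<open>m \<in> M\<close> by (auto simp: matching_def)
    then show ?thesis
      by (cases l) (auto simp: links_def src_def tgt_def)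
  qed
  define meets where "meets h v \<longleftrightarrow> (\<exists>i. {Inl (v, i), Inr (node h)} \<in> M)" for h v
  \<comment> \<open>On a loop with a shared node, \<open>meets\<close> cannot tell the two
    half-edges apart. Taking the complement for \<open>(e, True)\<close> ensures that exactly one is
    selected.\<close>
  define q where "q h = (if P (fst h) \<or> \<not> snd h then meets h (endpoint G h)
    else \<not> meets (fst h, False) (endpoint G (fst h, False)))" for h

  have q_par: "q (e, b) \<longleftrightarrow> {Inr (e, False), Inr (e, True)} \<notin> M" if e: "e \<in> edges G" "P e" for e b
  proof
    assume "q (e, b)"
    then obtain i where i: "{Inl (endpoint G (e, b), i), Inr (e, b)} \<in> M"
      using e by (auto simp: q_def meets_def node_def)
    show "{Inr (e, False), Inr (e, True)} \<notin> M"
    proof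
      assume "{Inr (e, False), Inr (e, True)} \<in> M"
      from uniq[OF i this, of "Inr (e, b)"] show False by (cases b) auto
    qed
  next
    assume nM: "{Inr (e, False), Inr (e, True)} \<notin> M"
    have "Inr (e, b) \<in> \<Union>M" using e by (simp add: cover Inr_in_nodes_iff)
    then obtain m where m: "m \<in> M" "Inr (e, b) \<in> m" by blast
    from M_cases[OF m(1)] show "q (e, b)"
    proof (elim disjE exE conjE)
      fix h i assume h: "h \<in> half_edges G" "m = {Inl (endpoint G h, i), Inr (node h)}"
      then have "node h = (e, b)" using m(2) by auto
      then have "h = (e, b)" using e(2) by (auto simp: node_def split: if_splits)
      then show ?thesis using m(1) h(2) e(2) by (auto simp: q_def meets_def)
    next
      fix e' assume "m = {Inr (e', False), Inr (e', True)}"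
      then show ?thesis using m nM by auto
    qed
  qed
  have q_opp: "q (e, True) = (\<not> q (e, False))" if "\<not> P e" for e
    using that by (simp add: q_def)

  have count: "card {h \<in> half_edges_at G v. q h} = N v" if v: "v \<in> vertices G" for v
  proof -
    define Q where "Q = {h \<in> half_edges_at G v. q h}"
    \<comment> \<open>The index of the core matched to the node of \<open>h\<close>; it will be a
      bijection from the selected half-edges at \<open>v\<close> to the cores of
      \<open>v\<close>.\<close>
    define f where "f h = (SOME i. {Inl (v, i), Inr (node h)} \<in> M)" for h
    have fM: "{Inl (v, f h), Inr (node h)} \<in> M" if h: "h \<in> Q" for h
    proof -
      obtain e b where eb: "h = (e, b)" by (cases h)
      have hv: "e \<in> edges G" "endpoint G (e, b) = v" "q (e, b)"
        using h by (auto simp: Q_def eb half_edges_at_def half_edge_iff)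
      have "\<exists>i. {Inl (v, i), Inr (node h)} \<in> M"
      proof (cases "P e \<or> \<not> b")
        case True
        then show ?thesis using hv by (auto simp: q_def meets_def eb)
      next
        case False
        \<comment> \<open>Here \<open>h\<close> is \<open>(e, True)\<close>. The shared node is
          matched to a core, but not to one at the end of \<open>(e, False)\<close>, so it is one at
          \<open>v\<close>.\<close>
        then have not_meets: "\<not> meets (e, False) (endpoint G (e, False))" using hv by (simp add: q_def)
        have "Inr (e, False) \<in> \<Union>M" using hv(1) by (simp add: cover Inr_in_nodes_iff)
        then obtain m where m: "m \<in> M" "Inr (e, False) \<in> m" by blast
        from M_cases[OF m(1)] show ?thesis
        proof (elim disjE exE conjE)
          fix h' i assume h': "h' \<in> half_edges G" "m = {Inl (endpoint G h', i), Inr (node h')}"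
          then have n: "node h' = (e, False)" using m(2) by auto
          then have "fst h' = e" by (auto simp: node_def split: if_splits)
          moreover have "h' \<noteq> (e, False)" using not_meets m(1) h'(2) by (auto simp: meets_def)
          ultimately have "h' = h" using False by (cases h') (auto simp: eb)
          then show ?thesis using m(1) h'(2) hv(2) by (auto simp: eb)
        next
          fix e' assume "P e'" "m = {Inr (e', False), Inr (e', True)}"
          then show ?thesis using m(2) False by auto
        qed
      qed
      then show ?thesis unfolding f_def by (rule someI_ex)
    qed
    have f_eq: "f h = i" if "h \<in> Q" "{Inl (v, i), Inr (node h)} \<in> M" for h i
    proof -
      have "{Inl (v, f h), Inr (node h)} = {Inl (v, i), Inr (node h)}"
        by (rule uniq[OF fM[OF that(1)] that(2), of "Inr (node h)"]) auto
      then show ?thesis by (auto simp: doubleton_eq_iff)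
    qed
    have "inj_on f Q"
    proof (rule inj_onI)
      fix h h' assume h: "h \<in> Q" "h' \<in> Q" "f h = f h'"
      have "{Inl (v, f h), Inr (node h)} = {Inl (v, f h'), Inr (node h')}"
        by (rule uniq[OF fM[OF h(1)] fM[OF h(2)], of "Inl (v, f h)"]) (use h(3) in auto)
      then have "node h = node h'" by (auto simp: doubleton_eq_iff)
      then have "h = h' \<or> (fst h = fst h' \<and> \<not> P (fst h) \<and> snd h \<noteq> snd h')"
        by (cases h; cases h') (auto simp: node_def split: if_splits)
      moreover have "q h" "q h'" using h by (auto simp: Q_def)
      ultimately show "h = h'"
        using q_opp[of "fst h"] by (cases h; cases h'; cases "snd h") auto
    qed
    moreover have "f ` Q = {..<N v}"
    proof
      show "f ` Q \<subseteq> {..<N v}"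
      proof clarify
        fix e b assume "(e, b) \<in> Q"
        from fM[OF this] have "Inl (v, f (e, b)) \<in> nodes" unfolding cover[symmetric] by blast
        then show "f (e, b) < N v" by (simp add: Inl_in_nodes_iff)
      qed
      show "{..<N v} \<subseteq> f ` Q"
      proof
        fix i assume "i \<in> {..<N v}"
        then have "Inl (v, i) \<in> \<Union>M" using v by (simp add: cover Inl_in_nodes_iff)
        then obtain m where m: "m \<in> M" "Inl (v, i) \<in> m" by blast
        then obtain h where h: "h \<in> half_edges G" "endpoint G h = v"
          and hM: "{Inl (v, i), Inr (node h)} \<in> M"
          using M_cases[OF m(1)] by auto
        have "\<exists>h'\<in>Q. node h' = node h"
        proof (cases "q h")
          case True
          then have "h \<in> Q" using h by (simp add: Q_def half_edges_at_def)
          then show ?thesis by blast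
        next
          case False
          \<comment> \<open>An unselected \<open>h\<close> whose node is matched to a core of
            \<open>v\<close> must be the second half-edge of a loop at \<open>v\<close>; the
            selected half-edge is then \<open>(e, False)\<close>, with the same node.\<close>
          obtain e b where eb: "h = (e, b)" by (cases h)
          have "meets h v" using hM by (auto simp: meets_def)
          then have e: "\<not> P e" "b" "meets (e, False) (endpoint G (e, False))"
            using False h by (auto simp: q_def eb split: if_splits)
          then obtain j where j: "{Inl (endpoint G (e, False), j), Inr (node (e, False))} \<in> M"
            by (auto simp: meets_def)
          have n: "node (e, False) = node h" using e by (simp add: node_def eb)
          have "{Inl (endpoint G (e, False), j), Inr (node (e, False))} = {Inl (v, i), Inr (node h)}"
            by (rule uniq[OF j hM, of "Inr (node h)"]) (use n in auto)
          then have "endpoint G (e, False) = v" by (auto simp: doubleton_eq_iff)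
          moreover have "q (e, False)" using e by (simp add: q_def)
          ultimately have "(e, False) \<in> Q"
            using h(1) by (simp add: Q_def half_edges_at_def half_edge_iff eb)
          then show ?thesis using n by blast
        qed
        then obtain h' where h': "h' \<in> Q" "node h' = node h" by blast
        then have "f h' = i" using hM by (intro f_eq) auto
        then show "i \<in> f ` Q" using h'(1) by blast
      qed
    qed
    ultimately have "card Q = card {..<N v}" using card_image by metis
    then show ?thesis by (simp add: Q_def)
  qed
  show thesis
    by (rule that[of q]) (use q_par q_opp count in auto)
qed

end

section \<open>Bridges and flows\<close>

lemma equiv_connected:
  "equiv (vertices G) {(u, v) \<in> vertices G \<times> vertices G. (u, v) \<in> (adjacency G)\<^sup>*}"
proof (rule equivI)
  have "(endpoint G (e, \<not> b), endpoint G (e, b)) \<in> adjacency G" if "e \<in> edges G" for e b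
    using that unfolding adjacency_def by (intro CollectI exI[of _ e] exI[of _ "\<not> b"]) simp
  then have "sym (adjacency G)" by (auto simp: sym_def adjacency_def)
  then have "sym ((adjacency G)\<^sup>*)" by (rule sym_rtrancl)
  then show "sym {(u, v) \<in> vertices G \<times> vertices G. (u, v) \<in> (adjacency G)\<^sup>*}"
    by (auto simp: sym_def)
  show "trans {(u, v) \<in> vertices G \<times> vertices G. (u, v) \<in> (adjacency G)\<^sup>*}"
    by (auto simp: trans_def intro: rtrancl_trans)
qed (auto simp: refl_on_def)

text \<open>Without \<open>e\<close> no walk changes sides of \<open>U\<close>, so the ends of
  \<open>e\<close> fall into different components. Every component of the smaller graph lies in one
  of \<open>G\<close>, and this surjection identifies two of them.\<close>

lemma single_crossing_edge_is_odd_edge_cut: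
  fixes G :: "('v, 'e) multigraph"
  assumes fin: "finite_multigraph G"
    and X: "{e' \<in> edges G. (endpoint G (e', False) \<in> U) \<noteq> (endpoint G (e', True) \<in> U)} = {e}"
  shows "odd_edge_cut G 1 {e}"
proof -
  define H where "H = delete_edges G {e}"
  define R where "R K = {(u, v) \<in> vertices K \<times> vertices K. (u, v) \<in> (adjacency K)\<^sup>*}"
    for K :: "('v, 'e) multigraph"
  have e: "e \<in> edges G" and cross: "(endpoint G (e, False) \<in> U) \<noteq> (endpoint G (e, True) \<in> U)"
    using X by auto
  have VH: "vertices H = vertices G" by (simp add: H_def delete_edges_def)
  have fV: "finite (vertices G)" using fin by (simp add: finite_multigraph_def)
  define x y where "x = endpoint G (e, False)" and "y = endpoint G (e, True)"
  have xy: "x \<in> vertices G" "y \<in> vertices G"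
    using fin e by (auto simp: finite_multigraph_def half_edges_def x_def y_def)
  have eqG: "equiv (vertices G) (R G)" and eqH: "equiv (vertices G) (R H)"
    using equiv_connected[of G] equiv_connected[of H] by (simp_all add: R_def VH)
  have "adjacency H \<subseteq> adjacency G"
    by (auto simp: adjacency_def H_def delete_edges_def)
  then have RHG: "R H \<subseteq> R G" using rtrancl_mono[of "adjacency H" "adjacency G"] by (auto simp: R_def VH)
  have side: "(u \<in> U) = (v \<in> U)" if "(u, v) \<in> (adjacency H)\<^sup>*" for u v
    using that
  proof (induction rule: rtrancl_induct)
    case (step v w)
    then obtain e' b where e': "e' \<in> edges G" "e' \<noteq> e"
      "v = endpoint G (e', b)" "w = endpoint G (e', \<not> b)"
      by (auto simp: adjacency_def H_def delete_edges_def)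
    then have "(endpoint G (e', False) \<in> U) = (endpoint G (e', True) \<in> U)" using X by blast
    then have "(v \<in> U) = (w \<in> U)" using e' by (cases b) auto
    then show ?case using step by simp
  qed simp
  have nH: "(x, y) \<notin> R H" using side[of x y] cross by (auto simp: R_def x_def y_def)
  have "(x, y) \<in> adjacency G"
    unfolding adjacency_def x_def y_def using e by force
  then have yG: "(x, y) \<in> R G" using xy by (auto simp: R_def)
  \<comment> \<open>Sends a component of \<open>H\<close> to the component of \<open>G\<close> that
    contains it.\<close>
  define \<phi> where "\<phi> C = R G `` C" for C
  have \<phi>: "\<phi> (R H `` {v}) = R G `` {v}" if "v \<in> vertices G" for v
  proof
    show "\<phi> (R H `` {v}) \<subseteq> R G `` {v}"
      using RHG eqG unfolding \<phi>_def equiv_def trans_def by blast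
    have "(v, v) \<in> R H" using that by (simp add: R_def VH)
    then show "R G `` {v} \<subseteq> \<phi> (R H `` {v})" unfolding \<phi>_def by blast
  qed
  have cH: "components H = (\<lambda>v. R H `` {v}) ` vertices G"
    and cG: "components G = (\<lambda>v. R G `` {v}) ` vertices G"
    by (auto simp: components_def quotient_def R_def VH)
  have img: "components G = \<phi> ` components H"
    unfolding cH cG image_image using \<phi> by (intro image_cong) auto
  have fH: "finite (components H)" using fV by (simp add: cH)
  have "\<not> inj_on \<phi> (components H)"
  proof
    assume inj: "inj_on \<phi> (components H)"
    have "R G `` {x} = R G `` {y}" using equiv_class_eq[OF eqG yG] .
    then have "\<phi> (R H `` {x}) = \<phi> (R H `` {y})" using \<phi> xy by simp
    then have "R H `` {x} = R H `` {y}" by (rule inj_onD[OF inj]) (use xy in \<open>simp_all add: cH\<close>)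
    then show False using eq_equiv_class[OF _ eqH xy(2)] nH by simp
  qed
  then have "card (components G) < card (components H)"
    unfolding img using card_image_le[OF fH, of \<phi>] eq_card_imp_inj_on[OF fH, of \<phi>]
    by (auto simp: le_less)
  then show ?thesis using e by (simp add: odd_edge_cut_def H_def)
qed

lemma integer_flow_of_modulo_flow:
  fixes p :: nat and G :: "('v, 'e) multigraph"
  assumes p: "p > 0" and fin: "finite_multigraph G"
    and bridgeless: "\<And>e. \<not> odd_edge_cut G 1 {e}"
    and \<tau>: "\<And>h. h \<in> half_edges G \<Longrightarrow> \<tau> h = 1 \<or> \<tau> h = -1"
    and f: "modulo_circular_flow G \<tau> (2 * p + 1) p f"
  shows "\<exists>g. integer_circular_flow G \<tau> (2 * p + 1) p g"
proof -
  define k where "k = int (2 * p + 1)"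
  define Z where "Z h = nat ((- f (fst h) * \<tau> h) mod k)" for h
  define P where "P e \<longleftrightarrow> \<tau> (e, True) = \<tau> (e, False)" for e
  define N where "N v = (\<Sum>h\<in>half_edges_at G v. Z h) div (2 * p + 1)" for v
  have k0: "k > 0" by (simp add: k_def)
  have Zint: "int (Z h) = (- f (fst h) * \<tau> h) mod k" for h
    using k0 by (simp add: Z_def)
  have f_cases: "f e = int p \<or> f e = int p + 1 \<or> f e = - int p \<or> f e = - int p - 1" if "e \<in> edges G" for e
  proof -
    have "int p \<le> \<bar>f e\<bar> \<and> \<bar>f e\<bar> \<le> int (2 * p + 1) - int p"
      using f that by (auto simp: modulo_circular_flow_def)
    then show ?thesis by auto
  qed
  have \<tau>e: "\<tau> (e, b) = 1 \<or> \<tau> (e, b) = -1" if "e \<in> edges G" for e b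
    using \<tau>[of "(e, b)"] that by (simp add: half_edges_def)
  have Z_vals: "int (Z (e, b)) = (if f e * \<tau> (e, b) \<in> {- int p, int p + 1} then int p else int p + 1)"
    if "e \<in> edges G" for e b
  proof -
    define t where "t = f e * \<tau> (e, b)"
    \<comment> \<open>For \<open>t\<close> equal to \<open>- p\<close> or \<open>- p - 1\<close> the
      residue is \<open>- t\<close> itself; for \<open>p\<close> or \<open>p + 1\<close> it is
      \<open>- t + k\<close>.\<close>
    have mods: "(- t) mod k = x" if "- t = x \<or> - t = x - k" "0 \<le> x" "x < k" for x
      using that by (metis mod_pos_pos_trivial mod_add_self2 diff_add_cancel)
    have "t = int p \<or> t = int p + 1 \<or> t = - int p \<or> t = - int p - 1"
      using f_cases[OF that] \<tau>e[OF that, of b] by (auto simp: t_def)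
    then have "(- t) mod k = (if t \<in> {- int p, int p + 1} then int p else int p + 1)"
      using p by (intro mods) (auto simp: k_def)
    then show ?thesis by (simp add: Zint t_def)
  qed
  have Z_opp: "Z (e, False) + Z (e, True) = 2 * p + 1" if e: "e \<in> edges G" "\<not> P e" for e
  proof -
    have "\<tau> (e, True) = - \<tau> (e, False)" using \<tau>e[OF e(1)] e(2) unfolding P_def by (metis minus_minus)
    then have "int (Z (e, False)) + int (Z (e, True)) = 2 * int p + 1"
      using Z_vals[OF e(1), of False] Z_vals[OF e(1), of True] f_cases[OF e(1)] \<tau>e[OF e(1), of False] p
      by auto
    then show ?thesis by linarith
  qed
  have Z_par: "Z (e, True) = Z (e, False)" if "P e" for e
    using that by (simp add: Z_def P_def)
  have N: "(2 * p + 1) * N v = (\<Sum>h\<in>half_edges_at G v. Z h)" if v: "v \<in> vertices G" for v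
  proof -
    have "[(\<Sum>h\<in>half_edges_at G v. int (Z h)) = (\<Sum>h\<in>half_edges_at G v. - (f (fst h) * \<tau> h))] (mod k)"
      by (rule cong_sum) (simp add: Zint cong_def)
    also have "(\<Sum>h\<in>half_edges_at G v. - (f (fst h) * \<tau> h)) = - boundary G \<tau> f v"
      by (simp add: boundary_def sum_negf)
    finally have "[(\<Sum>h\<in>half_edges_at G v. int (Z h)) = - boundary G \<tau> f v] (mod k)" .
    moreover have "k dvd boundary G \<tau> f v"
      using f v by (auto simp: modulo_circular_flow_def k_def cong_0_iff)
    ultimately have "k dvd (\<Sum>h\<in>half_edges_at G v. int (Z h))"
      by (simp add: cong_dvd_iff)
    then have "2 * p + 1 dvd (\<Sum>h\<in>half_edges_at G v. Z h)"
      unfolding k_def of_nat_sum[symmetric] of_nat_dvd_iff .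
    then show ?thesis unfolding N_def by (rule dvd_mult_div_cancel)
  qed
  interpret half_edge_weights G p Z P N
  proof
    show "Z h = p \<or> Z h = p + 1" if "h \<in> half_edges G" for h
      using Z_vals[of "fst h" "snd h"] that by (auto simp: half_edges_def split: if_splits)
    show "{e' \<in> edges G. (endpoint G (e', False) \<in> U) \<noteq> (endpoint G (e', True) \<in> U)} \<noteq> {e}" for U e
      using single_crossing_edge_is_odd_edge_cut[OF fin] bridgeless by blast
  qed (use p fin Z_par Z_opp N in auto)
  obtain q where q_par: "\<And>e. e \<in> edges G \<Longrightarrow> P e \<Longrightarrow> q (e, True) = q (e, False)"
    and q_opp: "\<And>e. e \<in> edges G \<Longrightarrow> \<not> P e \<Longrightarrow> q (e, True) = (\<not> q (e, False))"
    and q_card: "\<And>v. v \<in> vertices G \<Longrightarrow> card {h \<in> half_edges_at G v. q h} = N v"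
    using selection_exists by blast
  \<comment> \<open>The intended value of \<open>g\<close> times \<open>\<tau>\<close> at
    \<open>h\<close>. It is congruent to \<open>f (fst h) * \<tau> h\<close> modulo
    \<open>k\<close>, and both \<open>- Z h\<close> and \<open>k - Z h\<close> have absolute value
    \<open>p\<close> or \<open>p + 1\<close> on half-edges of \<open>G\<close>.\<close>
  define d where "d h = k * of_bool (q h) - int (Z h)" for h
  define g where "g e = d (e, False) * \<tau> (e, False)" for e
  \<comment> \<open>Since \<open>g\<close> is read off at \<open>(e, False)\<close>, the other
    half-edge must agree: \<open>d\<close> takes equal values there if \<open>P e\<close> and
    opposite values otherwise, by the two rules for \<open>q\<close>.\<close>
  have g\<tau>: "g e * \<tau> (e, b) = d (e, b)" if e: "e \<in> edges G" for e b
  proof (cases b)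
    case False
    then show ?thesis using \<tau>e[OF e, of False] by (auto simp: g_def)
  next
    case True
    show ?thesis
    proof (cases "P e")
      case Pe: True
      then show ?thesis
        using \<tau>e[OF e, of False] q_par[OF e] Z_par True by (auto simp: g_def d_def P_def)
    next
      case nP: False
      then have t: "\<tau> (e, True) = - \<tau> (e, False)" using \<tau>e[OF e] unfolding P_def by (metis minus_minus)
      have "int (Z (e, False)) + int (Z (e, True)) = k"
        using Z_opp[OF e nP] by (simp add: k_def flip: of_nat_add)
      then have "d (e, True) = - d (e, False)" using q_opp[OF e nP] by (auto simp: d_def)
      then show ?thesis using t \<tau>e[OF e, of False] True by (auto simp: g_def)
    qed
  qed
  have "int p \<le> \<bar>g e\<bar> \<and> \<bar>g e\<bar> \<le> int (2 * p + 1) - int p" if e: "e \<in> edges G" for e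
    using \<tau>e[OF e, of False] Z_vals[OF e, of False] p
    by (auto simp: g_def d_def k_def of_bool_def split: if_splits)
  moreover have "boundary G \<tau> g v = 0" if v: "v \<in> vertices G" for v
  proof -
    have "boundary G \<tau> g v = (\<Sum>h\<in>half_edges_at G v. d h)"
      unfolding boundary_def by (rule sum.cong) (auto simp: half_edges_at_def half_edges_def g\<tau>)
    also have "\<dots> = k * (\<Sum>h\<in>half_edges_at G v. of_bool (q h)) - int (\<Sum>h\<in>half_edges_at G v. Z h)"
      by (simp only: d_def sum_subtractf sum_distrib_left of_nat_sum)
    also have "(\<Sum>h\<in>half_edges_at G v. of_bool (q h)) = int (N v)"
    proof -
      have "half_edges_at G v \<inter> {h. q h} = {h \<in> half_edges_at G v. q h}" by blast
      then show ?thesis using q_card[OF v] finite_half_edges_at by (simp add: sum_of_bool_eq)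
    qed
    also have "k * int (N v) = int (\<Sum>h\<in>half_edges_at G v. Z h)"
      unfolding k_def of_nat_mult[symmetric] N[OF v] ..
    finally show ?thesis by simp
  qed
  ultimately show ?thesis unfolding integer_circular_flow_def by blast
qed

theorem theorem1p8:
  fixes p :: nat
    and G :: "('v, 'e) multigraph"
    and \<sigma> :: "'e \<Rightarrow> int"
    and \<tau> :: "'e \<times> bool \<Rightarrow> int"
  assumes "p > 0"
    and "finite_multigraph G"
    and "signature G \<sigma>"
    and "orientation G \<sigma> \<tau>"
    and "odd_edge_connected (2 * p + 1) G"
  shows "(\<exists>f. modulo_circular_flow G \<tau> (2 * p + 1) p f) \<longleftrightarrow>
         (\<exists>f. integer_circular_flow G \<tau> (2 * p + 1) p f)"
proof
  assume "\<exists>f. modulo_circular_flow G \<tau> (2 * p + 1) p f"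
  \<comment> \<open>\<open>p > 0\<close> gives \<open>1 + 2 \<le> 2 * p + 1\<close>, so cuts of size
    1 are among those excluded.\<close>
  moreover have "\<not> odd_edge_cut G 1 {e}" for e
    using assms(1,5) unfolding odd_edge_connected_def by force
  moreover have "\<tau> h = 1 \<or> \<tau> h = -1" if "h \<in> half_edges G" for h
    using assms(4) that by (auto simp: orientation_def)
  ultimately show "\<exists>f. integer_circular_flow G \<tau> (2 * p + 1) p f"
    using integer_flow_of_modulo_flow[OF assms(1,2)] by blast
next
  assume "\<exists>f. integer_circular_flow G \<tau> (2 * p + 1) p f"
  then show "\<exists>f. modulo_circular_flow G \<tau> (2 * p + 1) p f"
    by (auto simp: integer_circular_flow_def modulo_circular_flow_def)
qed

end
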